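(* Let $n$ be an odd positive integer and let $D^*_n = \langle x,t \mid x^n = t^4 = 1,\ t^{-1}xt = x^{-1}\rangle$. Then $D^*_n$ contains $(4n, 2n-1, n-1)$ sum sets, and these sum sets are type 2 with respect to the center $\{1, t^2\}$ of $D^*_n$.
   Context: For a finite group $X$ of order $w$, $T\subseteq X$ with $|T|=k$ is a $(w,k,\mu)$ sum set if every nonidentity element $a\in X$ admits exactly $\mu$ ordered pairs $(y_1,y_2)\in T\times T$ with $y_1y_2 = a$. For a normal subgroup $N$ of order $2$, a sum set $T$ is type 2 with respect to $N$ if $|T\cap N|=1$ and $T$ meets each other coset of $N$ in $0$ or $2$ elements.
   Formalization: The identification of {1, t^2} with the center is asserted only for n > 1, since for n = 1 the group is cyclic of order 4 and is its own center; existence and type 2 with respect to {1, t^2} are proved for every odd n. *)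

theory Defs
  imports "HOL-Algebra.Coset"
begin

section \<open>Groups given by generators and relations\<close>

text \<open>
  The letter \<open>(a, True)\<close> stands for the generator \<open>a\<close>, the letter \<open>(a, False)\<close> for its
  formal inverse. A relation \<open>u = v\<close> is the pair of words \<open>(u, v)\<close>.
\<close>

type_synonym 'a word = "('a \<times> bool) list"

text \<open>The congruence on words generated by free cancellation and the relations \<open>R\<close>.\<close>

inductive word_eq :: "('a word \<times> 'a word) set \<Rightarrow> 'a word \<Rightarrow> 'a word \<Rightarrow> bool"
  for R :: "('a word \<times> 'a word) set"
where
  refl: "word_eq R u u"
| sym: "word_eq R u v \<Longrightarrow> word_eq R v u"
| trans: "word_eq R u v \<Longrightarrow> word_eq R v w \<Longrightarrow> word_eq R u w"
| cancel: "word_eq R (u @ [(a, b), (a, \<not> b)] @ v) (u @ v)"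
| relation: "(l, r) \<in> R \<Longrightarrow> word_eq R (u @ l @ v) (u @ r @ v)"

definition word_class :: "('a word \<times> 'a word) set \<Rightarrow> 'a word \<Rightarrow> 'a word set"
  where "word_class R u = {v. word_eq R u v}"

text \<open>
  The group presented by all elements of the type \<open>'a\<close> as generators, subject to the
  relations \<open>R\<close>: words modulo \<open>word_eq R\<close>, multiplied by concatenation.
\<close>

definition presented_group :: "('a word \<times> 'a word) set \<Rightarrow> 'a word set monoid"
  where "presented_group R =
    \<lparr>carrier = range (word_class R),
     mult = (\<lambda>A B. {w. \<exists>u\<in>A. \<exists>v\<in>B. word_eq R (u @ v) w}),
     one = word_class R []\<rparr>"

lemma word_eq_append_context:
  "word_eq R u v \<Longrightarrow> word_eq R (p @ u @ q) (p @ v @ q)"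
proof (induction rule: word_eq.induct)
  case (cancel u a b v)
  show ?case using word_eq.cancel[of R "p @ u" a b "v @ q"] by simp
next
  case (relation l r u v)
  show ?case using word_eq.relation[OF relation, of "p @ u" "v @ q"] by simp
qed (blast intro: word_eq.refl word_eq.sym word_eq.trans)+

lemma word_eq_append:
  assumes "word_eq R u u'" "word_eq R v v'"
  shows "word_eq R (u @ v) (u' @ v')"
  using word_eq_append_context[OF assms(1), of "[]" v]
    word_eq_append_context[OF assms(2), of u' "[]"]
  by (auto intro: word_eq.trans)

lemma word_class_eq_iff: "word_class R u = word_class R v \<longleftrightarrow> word_eq R u v"
  unfolding word_class_def by (blast intro: word_eq.refl word_eq.sym word_eq.trans)

lemma presented_group_mult:
  "word_class R u \<otimes>\<^bsub>presented_group R\<^esub> word_class R v = word_class R (u @ v)"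
  unfolding presented_group_def word_class_def
  by (auto intro: word_eq.refl word_eq.sym word_eq.trans word_eq_append)

lemma word_eq_inverse:
  "word_eq R (map (\<lambda>(a, b). (a, \<not> b)) (rev u) @ u) []"
proof (induction u)
  case Nil
  show ?case by (simp add: word_eq.refl)
next
  case (Cons l u)
  obtain a b where l: "l = (a, b)" by (cases l)
  let ?u' = "map (\<lambda>(a, b). (a, \<not> b)) (rev u)"
  have "word_eq R (?u' @ [(a, \<not> b), (a, \<not> \<not> b)] @ u) (?u' @ u)"
    by (rule word_eq.cancel)
  then show ?case using Cons.IH by (auto simp: l intro: word_eq.trans)
qed

lemma group_presented_group: "group (presented_group R)"
proof (rule groupI)
  let ?G = "presented_group R"
  have carrier: "carrier ?G = range (word_class R)" and one: "\<one>\<^bsub>?G\<^esub> = word_class R []"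
    by (simp_all add: presented_group_def)
  show "\<one>\<^bsub>?G\<^esub> \<in> carrier ?G" by (simp add: carrier one)
  fix A assume "A \<in> carrier ?G"
  then obtain u where A: "A = word_class R u" by (auto simp: carrier)
  show "\<one>\<^bsub>?G\<^esub> \<otimes>\<^bsub>?G\<^esub> A = A" by (simp add: A one presented_group_mult)
  show "\<exists>B\<in>carrier ?G. B \<otimes>\<^bsub>?G\<^esub> A = \<one>\<^bsub>?G\<^esub>"
    using word_eq_inverse[of R u]
    by (auto simp: A one carrier presented_group_mult word_class_eq_iff)
  fix B assume "B \<in> carrier ?G"
  then obtain v where B: "B = word_class R v" by (auto simp: carrier)
  show "A \<otimes>\<^bsub>?G\<^esub> B \<in> carrier ?G" by (simp add: A B carrier presented_group_mult)
  fix C assume "C \<in> carrier ?G"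
  then obtain w where C: "C = word_class R w" by (auto simp: carrier)
  show "A \<otimes>\<^bsub>?G\<^esub> B \<otimes>\<^bsub>?G\<^esub> C = A \<otimes>\<^bsub>?G\<^esub> (B \<otimes>\<^bsub>?G\<^esub> C)"
    by (simp add: A B C presented_group_mult)
qed


section \<open>The group $D^*_n$\<close>

datatype dgen = Gen_x | Gen_t

definition Dstar_rels :: "nat \<Rightarrow> (dgen word \<times> dgen word) set"
  where "Dstar_rels n =
    {(replicate n (Gen_x, True), []),
     (replicate 4 (Gen_t, True), []),
     ([(Gen_t, False), (Gen_x, True), (Gen_t, True)], [(Gen_x, False)])}"

definition Dstar :: "nat \<Rightarrow> dgen word set monoid"
  where "Dstar n = presented_group (Dstar_rels n)"

definition Dstar_t :: "nat \<Rightarrow> dgen word set"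
  where "Dstar_t n = word_class (Dstar_rels n) [(Gen_t, True)]"


section \<open>Sum sets\<close>

definition center :: "('a, 'b) monoid_scheme \<Rightarrow> 'a set"
  where "center G = {z \<in> carrier G. \<forall>g\<in>carrier G. z \<otimes>\<^bsub>G\<^esub> g = g \<otimes>\<^bsub>G\<^esub> z}"

definition sum_set ::
    "('a, 'b) monoid_scheme \<Rightarrow> nat \<Rightarrow> nat \<Rightarrow> nat \<Rightarrow> 'a set \<Rightarrow> bool"
  where "sum_set G w k \<mu> T \<longleftrightarrow>
    group G \<and> finite (carrier G) \<and> order G = w \<and>
    T \<subseteq> carrier G \<and> card T = k \<and>
    (\<forall>a \<in> carrier G - {\<one>\<^bsub>G\<^esub>}. card {(y1, y2) \<in> T \<times> T. y1 \<otimes>\<^bsub>G\<^esub> y2 = a} = \<mu>)"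

definition type2 :: "('a, 'b) monoid_scheme \<Rightarrow> 'a set \<Rightarrow> 'a set \<Rightarrow> bool"
  where "type2 G N T \<longleftrightarrow>
    N \<lhd> G \<and> card N = 2 \<and> card (T \<inter> N) = 1 \<and>
    (\<forall>C \<in> rcosets\<^bsub>G\<^esub> N. C \<noteq> N \<longrightarrow> card (T \<inter> C) \<in> {0, 2})"

end

theory Submission
  imports Defs
begin

text \<open>
  For a sum set \<open>T\<close> with these parameters the indicator \<open>f \<in> \<int>[D\<^sup>*\<^sub>n]\<close> satisfies
  \<open>f\<^sup>2 = 1 + (n - 1) \<Sum>g\<close>. Modulo \<open>t\<^sup>2 + 1\<close> it becomes \<open>A + B t\<close> with \<open>A, B \<in> \<int>[C\<^sub>n]\<close>, and writing
  \<open>A'\<close>, \<open>B'\<close> for the images under inversion,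
  \<open>A\<^sup>2 - B B' = 1\<close> and \<open>A B + A' B = 0\<close>. Hence \<open>B = A\<^sup>2 B - B B' B = - A A' B - B B' B\<close>, and pairing
  with \<open>B\<close> gives \<open>|B|\<^sup>2 = - |A' B|\<^sup>2 - |B' B|\<^sup>2\<close>, so \<open>B = 0\<close> and \<open>A\<^sup>2 = 1\<close>. As \<open>n\<close> is odd, reduction
  modulo 2 shows that \<open>A\<close> is odd at the identity and even elsewhere; its entries lie in
  \<open>{-1, 0, 1}\<close>, so they vanish off the identity. This says that \<open>T\<close> is of type 2.
  Conversely \<open>{1} \<union> {x\<^sup>i t\<^sup>j | 1 \<le> i \<le> (n - 1) / 2}\<close> is a sum set.
\<close>

section \<open>Functions on a cyclic group and their sums over a period\<close>

text \<open>Elements of the group algebra of the cyclic group of order n are coded by their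
  coefficients, as functions on all integers, so that indices such as \<open>k - i\<close> need no
  reduction modulo n.\<close>

definition periodic :: "nat \<Rightarrow> (int \<Rightarrow> 'a) \<Rightarrow> bool"
  where "periodic n f \<longleftrightarrow> (\<forall>i j. i mod int n = j mod int n \<longrightarrow> f i = f j)"

lemma periodicI: "(\<And>i j. i mod int n = j mod int n \<Longrightarrow> f i = f j) \<Longrightarrow> periodic n f"
  unfolding periodic_def by blast

lemma periodicD: "periodic n f \<Longrightarrow> i mod int n = j mod int n \<Longrightarrow> f i = f j"
  unfolding periodic_def by blast

lemma periodic_const: "periodic n (\<lambda>i. c)"
  by (simp add: periodic_def)

lemma periodic_diff_right: "periodic n f \<Longrightarrow> periodic n (\<lambda>i. f (i - c))"
  by (rule periodicI, erule periodicD, erule mod_diff_cong, rule HOL.refl)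

lemma periodic_diff_left: "periodic n f \<Longrightarrow> periodic n (\<lambda>i. f (c - i))"
  by (rule periodicI, erule periodicD, rule mod_diff_cong, rule HOL.refl)

lemma periodic_add_right: "periodic n f \<Longrightarrow> periodic n (\<lambda>i. f (i + c))"
  by (rule periodicI, erule periodicD, erule mod_add_cong, rule HOL.refl)

lemma periodic_mult:
  fixes f g :: "int \<Rightarrow> int"
  shows "periodic n f \<Longrightarrow> periodic n g \<Longrightarrow> periodic n (\<lambda>i. f i * g i)"
  by (rule periodicI, rule arg_cong2[of _ _ _ _ "(*)"]; erule periodicD, assumption)

lemma periodic_sum:
  fixes f :: "'b \<Rightarrow> int \<Rightarrow> int"
  shows "(\<And>j. periodic n (f j)) \<Longrightarrow> periodic n (\<lambda>i. \<Sum>j\<in>A. f j i)"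
  by (rule periodicI, rule sum.cong[OF HOL.refl], rule periodicD)

lemma sum_periodic_shift:
  fixes f :: "int \<Rightarrow> int"
  assumes "periodic n f" "n > 0"
  shows "(\<Sum>i=0..<int n. f (i + c)) = (\<Sum>i=0..<int n. f i)"
  by (rule sum.reindex_bij_witness[of _ "\<lambda>i. (i - c) mod int n" "\<lambda>i. (i + c) mod int n"])
    (use assms(2) in \<open>auto simp: mod_simps intro!: periodicD[OF assms(1)]\<close>)

lemma sum_periodic_reflect:
  fixes f :: "int \<Rightarrow> int"
  assumes "periodic n f" "n > 0"
  shows "(\<Sum>i=0..<int n. f (c - i)) = (\<Sum>i=0..<int n. f i)"
  by (rule sum.reindex_bij_witness[of _ "\<lambda>i. (c - i) mod int n" "\<lambda>i. (c - i) mod int n"])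
    (use assms(2) in \<open>auto simp: mod_simps intro!: periodicD[OF assms(1)]\<close>)

text \<open>Exactly one index in \<open>{0..<int n}\<close> is congruent to \<open>k\<close>, and
  there periodicity gives the value \<open>f k\<close>.\<close>

lemma sum_delta_mod:
  fixes f :: "int \<Rightarrow> int"
  assumes "periodic n f" "n > 0"
  shows "(\<Sum>i=0..<int n. f i * of_bool ((i - k) mod int n = 0)) = f k"
proof -
  have "(\<Sum>i=0..<int n. f i * of_bool ((i - k) mod int n = 0))
      = (\<Sum>i=0..<int n. if i = k mod int n then f k else 0)"
  proof (intro sum.cong HOL.refl)
    fix i assume i: "i \<in> {0..<int n}"
    have "(i - k) mod int n = 0 \<longleftrightarrow> i mod int n = k mod int n"
      by (simp only: mod_eq_dvd_iff mod_eq_0_iff_dvd)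
    then show "f i * of_bool ((i - k) mod int n = 0) = (if i = k mod int n then f k else 0)"
      using i periodicD[OF assms(1), of i k] by auto
  qed
  also have "\<dots> = f k" using assms(2) by simp
  finally show ?thesis .
qed

section \<open>Square roots of one in twisted and modular group algebras\<close>

text \<open>The hypotheses say that \<open>a + b t\<close> squares to \<open>1\<close> when \<open>t\<^sup>2 = -1\<close> and conjugation by \<open>t\<close> inverts
  the cyclic group.\<close>

lemma twisted_square_root_of_one:
  fixes a b :: "int \<Rightarrow> int"
  assumes n: "n > 0" and a: "periodic n a" and b: "periodic n b"
    and even_part: "\<And>k. (\<Sum>i=0..<int n. a i * a (k - i)) - (\<Sum>i=0..<int n. b i * b (i - k))
      = of_bool (k mod int n = 0)"
    and odd_part: "\<And>k. (\<Sum>i=0..<int n. a i * b (k - i)) + (\<Sum>i=0..<int n. b i * a (i - k)) = 0"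
  shows "b k = 0"
proof -
  let ?S = "\<lambda>f. \<Sum>i=0..<int n. f i :: int"
  \<comment> \<open>\<open>r\<close> lists the coefficients of B B' and \<open>u\<close> those of A'
    B, where A' and B' are the images of A and B under inversion.\<close>
  define r where "r j = ?S (\<lambda>i. b i * b (i - j))" for j
  define u where "u s = ?S (\<lambda>k. b k * a (k - s))" for s
  have conv: "periodic n (\<lambda>j. ?S (\<lambda>i. a i * a (j - i)))"
    by (rule periodic_sum, rule periodic_mult[OF periodic_const periodic_diff_right[OF a]])
  \<comment> \<open>\<open>odd_part\<close> reads A B + A' B = 0, so A B has the coefficients
    \<open>- u s\<close>.\<close>
  have v: "?S (\<lambda>l. b l * a (s - l)) = - u s" for s
  proof -
    have "periodic n (\<lambda>i. a i * b (s - i))"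
      by (rule periodic_mult[OF a periodic_diff_left[OF b]])
    from sum_periodic_reflect[OF this n, of s] odd_part[of s] show ?thesis
      by (simp add: u_def mult.commute)
  qed
  \<comment> \<open>The inner product of B B' with A^2 equals that of A' B with A B: the
    substitutions l = k - j and s = k - i separate the sums over k and l for fixed s. By
    \<open>v\<close> this is minus the squared norm of A' B.\<close>
  have cross: "?S (\<lambda>j. r j * ?S (\<lambda>i. a i * a (j - i))) = - ?S (\<lambda>s. u s ^ 2)"
  proof -
    have "?S (\<lambda>j. r j * ?S (\<lambda>i. a i * a (j - i)))
        = ?S (\<lambda>j. ?S (\<lambda>k. b k * b (k - j) * ?S (\<lambda>i. a i * a (j - i))))"
      by (simp add: r_def sum_distrib_right)
    also have "\<dots> = ?S (\<lambda>k. ?S (\<lambda>j. b k * b (k - j) * ?S (\<lambda>i. a i * a (j - i))))"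
      by (rule sum.swap)
    also have "\<dots> = ?S (\<lambda>k. ?S (\<lambda>l. b k * b l * ?S (\<lambda>i. a i * a (k - l - i))))"
    proof (rule sum.cong[OF HOL.refl])
      fix k
      have "periodic n (\<lambda>l. b k * b l * ?S (\<lambda>i. a i * a (k - l - i)))"
        by (rule periodic_mult[OF periodic_mult[OF periodic_const b] periodic_diff_left[OF conv]])
      from sum_periodic_reflect[OF this n, of k]
      show "?S (\<lambda>j. b k * b (k - j) * ?S (\<lambda>i. a i * a (j - i)))
        = ?S (\<lambda>l. b k * b l * ?S (\<lambda>i. a i * a (k - l - i)))" by simp
    qed
    also have "\<dots> = ?S (\<lambda>k. ?S (\<lambda>l. b k * b l * ?S (\<lambda>s. a (k - s) * a (s - l))))"
    proof (rule sum.cong[OF HOL.refl], rule sum.cong[OF HOL.refl])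
      fix k l
      have "periodic n (\<lambda>i. a i * a (k - l - i))"
        by (rule periodic_mult[OF a periodic_diff_left[OF a]])
      from sum_periodic_reflect[OF this n, of k]
      show "b k * b l * ?S (\<lambda>i. a i * a (k - l - i)) = b k * b l * ?S (\<lambda>s. a (k - s) * a (s - l))"
        by (simp add: algebra_simps)
    qed
    also have "\<dots> = ?S (\<lambda>k. ?S (\<lambda>l. ?S (\<lambda>s. (b k * a (k - s)) * (b l * a (s - l)))))"
      by (simp add: sum_distrib_left algebra_simps)
    also have "\<dots> = ?S (\<lambda>k. ?S (\<lambda>s. ?S (\<lambda>l. (b k * a (k - s)) * (b l * a (s - l)))))"
      by (rule sum.cong[OF HOL.refl sum.swap])
    also have "\<dots> = ?S (\<lambda>s. ?S (\<lambda>k. ?S (\<lambda>l. (b k * a (k - s)) * (b l * a (s - l)))))"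
      by (rule sum.swap)
    also have "\<dots> = ?S (\<lambda>s. u s * ?S (\<lambda>l. b l * a (s - l)))"
      by (simp add: u_def sum_product)
    also have "\<dots> = - ?S (\<lambda>s. u s ^ 2)"
      by (simp add: v power2_eq_square sum_negf)
    finally show ?thesis .
  qed
  have rper: "periodic n r"
    unfolding r_def
    by (rule periodic_sum, rule periodic_mult[OF periodic_const periodic_diff_left[OF b]])
  \<comment> \<open>The squared norm of B is the identity coefficient of B B', hence the inner
    product of B B' with the delta function at 0. \<open>even_part\<close> replaces the latter by
    A^2 - B B', so that a sum of squares becomes minus a sum of squares.\<close>
  have "?S (\<lambda>i. b i ^ 2) = r 0" by (simp add: r_def power2_eq_square)
  also have "\<dots> = ?S (\<lambda>j. r j * of_bool (j mod int n = 0))"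
    using sum_delta_mod[OF rper n, of 0] by simp
  also have "\<dots> = ?S (\<lambda>j. r j * ?S (\<lambda>i. a i * a (j - i)) - r j ^ 2)"
    by (simp only: even_part[symmetric] r_def[symmetric] right_diff_distrib power2_eq_square)
  also have "\<dots> = - ?S (\<lambda>s. u s ^ 2) - ?S (\<lambda>j. r j ^ 2)"
    by (simp add: sum_subtractf cross)
  also have "\<dots> \<le> 0"
    using sum_nonneg[of "{0..<int n}" "\<lambda>s. u s ^ 2"] sum_nonneg[of "{0..<int n}" "\<lambda>s. r s ^ 2"]
    by simp
  finally have "?S (\<lambda>i. b i ^ 2) = 0"
    using sum_nonneg[of "{0..<int n}" "\<lambda>s. b s ^ 2"] by simp
  then have "\<forall>i\<in>{0..<int n}. b i ^ 2 = 0" by (subst (asm) sum_nonneg_eq_0_iff) auto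
  moreover have "k mod int n \<in> {0..<int n}" using n by simp
  ultimately have "b (k mod int n) = 0" by auto
  then show ?thesis using periodicD[OF b, of "k mod int n" k] by simp
qed

text \<open>Over the field with two elements the Frobenius map is injective on the group algebra of a
  cyclic group of odd order.\<close>

lemma square_root_of_one_parity:
  fixes a :: "int \<Rightarrow> int"
  assumes "odd n" and a: "periodic n a"
    and sq: "\<And>k. (\<Sum>i=0..<int n. a i * a (k - i)) = of_bool (k mod int n = 0)"
  shows "odd (a k) \<longleftrightarrow> k mod int n = 0"
proof -
  have n: "n > 0" using \<open>odd n\<close> by (cases n) auto
  obtain m where m: "n = 2 * m + 1" using \<open>odd n\<close> by (auto elim: oddE)
  \<comment> \<open>The summands of the coefficient of A^2 at \<open>2 * k\<close>, recentred at
    \<open>k\<close>: \<open>g\<close> is an even function and \<open>g 0\<close> is the square of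
    \<open>a k\<close>.\<close>
  define g where "g i = a (i + k) * a (k - i)" for i
  have gper: "periodic n g"
    unfolding g_def by (rule periodic_mult[OF periodic_add_right[OF a] periodic_diff_left[OF a]])
  have "periodic n (\<lambda>i. a i * a (2 * k - i))"
    by (rule periodic_mult[OF a periodic_diff_left[OF a]])
  from sum_periodic_shift[OF this n, of k] sq[of "2 * k"]
  have "of_bool (2 * k mod int n = 0) = (\<Sum>i=0..<int n. g i)"
    by (simp add: g_def algebra_simps)
  \<comment> \<open>Since n = 2m + 1, the period can be moved to the interval from -m to m. There
    the terms at i and -i agree and cancel modulo 2, which leaves \<open>g 0\<close>.\<close>
  also have "\<dots> = (\<Sum>i=0..<int n. g (i + (- int m)))"
    using sum_periodic_shift[OF gper n, of "- int m"] by simp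
  also have "\<dots> = (\<Sum>i\<in>{- int m..int m}. g i)"
    by (rule sum.reindex_bij_witness[of _ "\<lambda>i. i + int m" "\<lambda>i. i - int m"]) (auto simp: m)
  also have "{- int m..int m} = {- int m..-1} \<union> ({0} \<union> {1..int m})" by auto
  also have "(\<Sum>i\<in>\<dots>. g i) = (\<Sum>i\<in>{- int m..-1}. g i) + (g 0 + (\<Sum>i\<in>{1..int m}. g i))"
    by (subst sum.union_disjoint; simp)+
  also have "(\<Sum>i\<in>{- int m..-1}. g i) = (\<Sum>i\<in>{1..int m}. g i)"
    by (rule sum.reindex_bij_witness[of _ uminus uminus]) (auto simp: g_def algebra_simps)
  finally have "odd (g 0) \<longleftrightarrow> 2 * k mod int n = 0"
    by (smt (verit) even_add of_bool_eq odd_one even_zero)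
  moreover have "odd (g 0) \<longleftrightarrow> odd (a k)" by (simp add: g_def)
  \<comment> \<open>2 is invertible modulo the odd number n.\<close>
  moreover have "2 * k mod int n = 0 \<longleftrightarrow> k mod int n = 0"
  proof -
    have "coprime (int n) 2" using \<open>odd n\<close> by simp
    then show ?thesis by (simp add: mod_eq_0_iff_dvd coprime_dvd_mult_right_iff)
  qed
  ultimately show ?thesis by simp
qed

section \<open>Dicyclic groups in coordinates\<close>

text \<open>The sign (-1)^j for integer j. It governs the rule t^j x^i = x^(alt j * i) t^j, because
  conjugation by t inverts x.\<close>

definition alt :: "int \<Rightarrow> int"
  where "alt j = (if even j then 1 else - 1)"

lemma alt_mult_alt: "alt j * (alt j * i) = i"
  by (simp add: alt_def)

lemma sum_atLeast0_lessThan_4: "(\<Sum>j=0..<4. f j) = f 0 + f 1 + f 2 + f (3 :: int)" for f :: "int \<Rightarrow> int"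
proof -
  have "{0..<4} = {0, 1, 2, 3 :: int}" by auto
  then show ?thesis by (simp add: add.assoc)
qed

text \<open>\<open>E i j\<close> plays the role of \<open>x\<^sup>i t\<^sup>j\<close>.\<close>

locale dicyclic = group G for G (structure) +
  fixes n :: nat and E :: "int \<Rightarrow> int \<Rightarrow> 'a"
  assumes odd_n: "odd n"
    and E_closed: "E i j \<in> carrier G"
    and E_cases: "g \<in> carrier G \<Longrightarrow> \<exists>i j. g = E i j"
    and E_mult: "E i j \<otimes> E i' j' = E (i + alt j * i') (j + j')"
    and E_eq: "E i j = E i' j' \<longleftrightarrow> i mod int n = i' mod int n \<and> j mod 4 = j' mod 4"
    and E_one: "E 0 0 = \<one>"
begin

lemma n_pos: "n > 0"
  using odd_n by (cases n) auto

lemma bij_E: "bij_betw (\<lambda>(i, j). E i j) ({0..<int n} \<times> {0..<4}) (carrier G)"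
proof (rule bij_betw_imageI)
  show "inj_on (\<lambda>(i, j). E i j) ({0..<int n} \<times> {0..<4})"
    by (auto simp: inj_on_def E_eq)
  show "(\<lambda>(i, j). E i j) ` ({0..<int n} \<times> {0..<4}) = carrier G"
  proof (intro equalityI subsetI)
    fix g assume "g \<in> carrier G"
    then obtain i j where "g = E i j" using E_cases by blast
    then have "g = (\<lambda>(i, j). E i j) (i mod int n, j mod 4)" by (simp add: E_eq)
    moreover have "(i mod int n, j mod 4) \<in> {0..<int n} \<times> {0..<4}" using n_pos by simp
    ultimately show "g \<in> (\<lambda>(i, j). E i j) ` ({0..<int n} \<times> {0..<4})" by (rule image_eqI)
  qed (auto simp: E_closed)
qed

lemma finite_carrier: "finite (carrier G)"
  using bij_betw_finite[OF bij_E] by simp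

lemma card_carrier: "card (carrier G) = 4 * n"
  using bij_betw_same_card[OF bij_E] by (simp add: card_cartesian_product)

lemma sum_carrier:
  fixes f :: "'a \<Rightarrow> int"
  shows "(\<Sum>g\<in>carrier G. f g) = (\<Sum>i=0..<int n. \<Sum>j=0..<4. f (E i j))"
  by (subst sum.reindex_bij_betw[OF bij_E, symmetric]) (simp add: sum.cartesian_product split_def)

text \<open>Gives the second factor when \<open>E k l\<close> is factored with first factor
  \<open>E i j\<close>; the sign \<open>alt j\<close> is its own inverse.\<close>

lemma inv_E_mult: "inv (E i j) \<otimes> E k l = E (alt j * (k - i)) (l - j)"
  by (rule inv_solve_left'[THEN iffD2]) (simp_all add: E_closed E_mult alt_mult_alt)

section \<open>Indicator functions and counts of factorizations\<close>

definition ind :: "'a set \<Rightarrow> int \<Rightarrow> int \<Rightarrow> int"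
  where "ind T i j = of_bool (E i j \<in> T)"

lemma ind_cong: "i mod int n = i' mod int n \<Longrightarrow> j mod 4 = j' mod 4 \<Longrightarrow> ind T i j = ind T i' j'"
  using E_eq[of i j i' j'] by (simp add: ind_def)

lemma card_eq_sum_ind:
  assumes "T \<subseteq> carrier G"
  shows "int (card T) = (\<Sum>i=0..<int n. \<Sum>j=0..<4. ind T i j)"
proof -
  have "int (card T) = (\<Sum>g\<in>carrier G. of_bool (g \<in> T))"
    using assms finite_carrier by (simp add: of_bool_def sum.If_cases Int_absorb1)
  then show ?thesis by (simp add: sum_carrier ind_def)
qed

text \<open>A factorization is determined by its first factor y, which is admissible when y and
  \<open>inv y \<otimes> E k l\<close> both lie in \<open>T\<close>. The right-hand side is a
  coefficient of the square of the indicator of \<open>T\<close> in the group ring.\<close>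

lemma card_factorizations:
  assumes T: "T \<subseteq> carrier G"
  shows "int (card {(y1, y2) \<in> T \<times> T. y1 \<otimes> y2 = E k l})
    = (\<Sum>i=0..<int n. \<Sum>j=0..<4. ind T i j * ind T (alt j * (k - i)) (l - j))"
proof -
  let ?A = "{y \<in> T. inv y \<otimes> E k l \<in> T}"
  have "bij_betw fst {(y1, y2) \<in> T \<times> T. y1 \<otimes> y2 = E k l} ?A"
  proof (rule bij_betw_byWitness[where f' = "\<lambda>y. (y, inv y \<otimes> E k l)"])
    show "\<forall>p\<in>{(y1, y2) \<in> T \<times> T. y1 \<otimes> y2 = E k l}. (fst p, inv (fst p) \<otimes> E k l) = p"
      using T E_closed[of k l] by (auto intro!: inv_solve_left'[THEN iffD2] dest: HOL.sym)
    show "fst ` {(y1, y2) \<in> T \<times> T. y1 \<otimes> y2 = E k l} \<subseteq> ?A"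
    proof safe
      fix y1 y2 assume y: "y1 \<in> T" "y2 \<in> T" and p: "y1 \<otimes> y2 = E k l"
      then have "inv y1 \<otimes> E k l = y2"
        using T E_closed[of k l] by (auto intro!: inv_solve_left'[THEN iffD2])
      then show "inv (fst (y1, y2)) \<otimes> E k l \<in> T" using y by simp
    qed auto
    show "(\<lambda>y. (y, inv y \<otimes> E k l)) ` ?A \<subseteq> {(y1, y2) \<in> T \<times> T. y1 \<otimes> y2 = E k l}"
      using T E_closed[of k l] by (auto simp: m_assoc[symmetric])
  qed auto
  then have "int (card {(y1, y2) \<in> T \<times> T. y1 \<otimes> y2 = E k l}) = int (card ?A)"
    by (simp add: bij_betw_same_card)
  also have "\<dots> = (\<Sum>i=0..<int n. \<Sum>j=0..<4. ind ?A i j)"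
    using T by (intro card_eq_sum_ind) auto
  also have "\<dots> = (\<Sum>i=0..<int n. \<Sum>j=0..<4. ind T i j * ind T (alt j * (k - i)) (l - j))"
    by (intro sum.cong HOL.refl) (simp add: ind_def inv_E_mult)
  finally show ?thesis .
qed

lemma sum_set_iff:
  "sum_set G (4 * n) (2 * n - 1) (n - 1) T \<longleftrightarrow> T \<subseteq> carrier G \<and> card T = 2 * n - 1 \<and>
    (\<forall>a\<in>carrier G - {\<one>}. card {(y1, y2) \<in> T \<times> T. y1 \<otimes> y2 = a} = n - 1)"
  using finite_carrier card_carrier is_group by (auto simp: sum_set_def order_def)

section \<open>Construction of a sum set\<close>

text \<open>Let P = x + ... + x^m, J = 1 + t + t^2 + t^3, let C be the sum of all powers of x, and
  let P' be the image of P under inversion. The set is 1 + P J in the group ring. From J P J = 2 (P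
  + P') J and P + P' = C - 1 its square is 1 + 2 P J + 2 P (C - 1) J = 1 + 2m C J, where C J is the
  sum of all group elements and 2m = n - 1.\<close>

lemma sum_set_exists: "\<exists>T. sum_set G (4 * n) (2 * n - 1) (n - 1) T"
proof -
  obtain m where m: "n = 2 * m + 1" using odd_n by (auto elim: oddE)
  define T where "T = insert \<one> {E i j | i j. 1 \<le> i \<and> i \<le> int m}"
  define p where "p i = (of_bool (1 \<le> i mod int n \<and> i mod int n \<le> int m) :: int)" for i
  define d where "d i = (of_bool (i mod int n = 0) :: int)" for i
  define e where "e j = (of_bool (j mod 4 = 0) :: int)" for j :: int
  have T: "T \<subseteq> carrier G" by (auto simp: T_def E_closed)
  have d_minus: "d (- i) = d i" for i by (simp only: d_def mod_eq_0_iff_dvd dvd_minus_iff)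
  \<comment> \<open>Negation exchanges the residues 1, ..., m with m + 1, ..., 2m, so it maps P to
    its complement among the nontrivial powers of x.\<close>
  have p_minus: "p i + p (- i) = 1 - d i" for i
  proof -
    obtain r where r: "i mod int n = r" "0 \<le> r" "r < int n" using n_pos by simp
    then have "(- i) mod int n = (if r = 0 then 0 else int n - r)"
      by (simp add: zmod_zminus1_eq_if)
    moreover have "int n = 2 * int m + 1" by (simp add: m)
    ultimately show ?thesis using r by (simp add: p_def d_def)
  qed
  have per_p: "periodic n p" and per_d: "periodic n d"
    by (auto intro!: periodicI simp: p_def d_def)
  have ind: "ind T i j = p i + d i * e j" for i j
  proof -
    have "E i j \<in> {E i j | i j. 1 \<le> i \<and> i \<le> int m} \<longleftrightarrow> 1 \<le> i mod int n \<and> i mod int n \<le> int m"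
    proof
      assume "E i j \<in> {E i j | i j. 1 \<le> i \<and> i \<le> int m}"
      then obtain i' where "1 \<le> i'" "i' \<le> int m" "i mod int n = i' mod int n"
        by (auto simp: E_eq)
      moreover have "i' mod int n = i'" using calculation by (simp add: m)
      ultimately show "1 \<le> i mod int n \<and> i mod int n \<le> int m" by simp
    next
      assume "1 \<le> i mod int n \<and> i mod int n \<le> int m"
      moreover have "E i j = E (i mod int n) j" by (simp add: E_eq)
      ultimately show "E i j \<in> {E i j | i j. 1 \<le> i \<and> i \<le> int m}" by blast
    qed
    moreover have "E i j = \<one> \<longleftrightarrow> i mod int n = 0 \<and> j mod 4 = 0"
      by (simp add: E_one[symmetric] E_eq)
    ultimately show ?thesis
      by (auto simp: ind_def T_def p_def d_def e_def)
  qed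
  have sum_p: "(\<Sum>i=0..<int n. p i) = int m"
  proof -
    have "(\<Sum>i=0..<int n. p i) = (\<Sum>i\<in>{1..int m}. 1)"
      by (rule sum.mono_neutral_cong_right) (auto simp: p_def m)
    then show ?thesis by simp
  qed
  have delta: "(\<Sum>i=0..<int n. f i * d (i - k)) = f k" if "periodic n f" for f k
    using sum_delta_mod[OF that n_pos, of k] by (simp add: d_def)
  have e_values: "e 0 = 1" "e 1 = 0" "e 2 = 0" "e 3 = 0" by (simp_all add: e_def)
  have "int (card T) = (\<Sum>i=0..<int n. 4 * p i + 1 * d (i - 0))"
    by (simp add: card_eq_sum_ind[OF T] ind sum_atLeast0_lessThan_4 e_values)
  also have "\<dots> = 4 * int m + 1"
    using delta[OF periodic_const, of 1 0] by (simp add: sum.distrib sum_distrib_left[symmetric] sum_p)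
  finally have card_T: "card T = 2 * n - 1" by (simp add: m)
  have count: "int (card {(y1, y2) \<in> T \<times> T. y1 \<otimes> y2 = E k l}) = int (n - 1) + d k * e l" for k l
  proof -
    have e_sum: "e l + e (l - 1) + e (l - 2) + e (l - 3) = 1"
      unfolding e_def by (simp only: of_bool_def) presburger
    \<comment> \<open>Even j contribute \<open>p (k - i)\<close> and odd j contribute
      \<open>p (i - k)\<close>; by \<open>p_minus\<close> these add up to
      \<open>1 - d (i - k)\<close>, which makes the products of two values of \<open>p\<close>
      linear. The \<open>e\<close> terms collapse by \<open>e_sum\<close>. The rest has the shape
      needed for \<open>sum_p\<close> and \<open>delta\<close>, whence the form
      \<open>d (i - 0)\<close>.\<close>
    have "int (card {(y1, y2) \<in> T \<times> T. y1 \<otimes> y2 = E k l}) = 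
        (\<Sum>i=0..<int n. 2 * p i - p i * d (i - k) + p (k - i) * d (i - 0) + (d (k - i) * e l) * d (i - 0))"
      unfolding card_factorizations[OF T]
    proof (rule sum.cong[OF HOL.refl])
      fix i
      have d': "d (k - i) = d (i - k)" using d_minus[of "i - k"] by simp
      have p': "p (i - k) = 1 - d (i - k) - p (k - i)" using p_minus[of "i - k"] by simp
      have "(\<Sum>j=0..<4. ind T i j * ind T (alt j * (k - i)) (l - j))
        = (p i + d i) * (p (k - i) + d (k - i) * e l) + p i * (p (i - k) + d (i - k) * e (l - 1))
        + p i * (p (k - i) + d (k - i) * e (l - 2)) + p i * (p (i - k) + d (i - k) * e (l - 3))"
        by (simp add: sum_atLeast0_lessThan_4 ind alt_def e_values)
      also have "\<dots> = 2 * p i * (p (k - i) + p (i - k))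
        + p i * d (i - k) * (e l + e (l - 1) + e (l - 2) + e (l - 3))
        + p (k - i) * d i + d (k - i) * e l * d i"
        by (simp add: d' algebra_simps)
      also have "\<dots> = 2 * p i - p i * d (i - k) + p (k - i) * d (i - 0) + (d (k - i) * e l) * d (i - 0)"
        unfolding e_sum p' by (simp add: algebra_simps)
      finally show "(\<Sum>j=0..<4. ind T i j * ind T (alt j * (k - i)) (l - j)) = \<dots>" .
    qed
    also have "\<dots> = 2 * int m - p k + p k + d k * e l"
      using delta[OF per_p, of k] delta[OF periodic_diff_left[OF per_p], of k 0]
        delta[OF periodic_mult[OF periodic_diff_left[OF per_d] periodic_const], of k "e l" 0]
      by (simp add: sum.distrib sum_subtractf sum_distrib_left[symmetric] sum_p)
    finally show ?thesis by (simp add: m)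
  qed
  have "card {(y1, y2) \<in> T \<times> T. y1 \<otimes> y2 = a} = n - 1" if a: "a \<in> carrier G - {\<one>}" for a
  proof -
    obtain k l where kl: "a = E k l" using a E_cases by blast
    then have "\<not> (k mod int n = 0 \<and> l mod 4 = 0)"
      using a by (simp add: E_one[symmetric] E_eq)
    then have "d k * e l = 0" by (auto simp: d_def e_def)
    then show ?thesis using count[of k l] unfolding kl by linarith
  qed
  then show ?thesis using T card_T sum_set_iff by blast
qed

section \<open>Sum sets are of type 2\<close>

text \<open>The definition prescribes no count at the identity. Counting all pairs of
  \<open>T \<times> T\<close> by their product determines it: (2n - 1)^2 - (4n - 1)(n - 1) =
  n.\<close>

lemma card_factorizations_one:
  assumes "sum_set G (4 * n) (2 * n - 1) (n - 1) T"
  shows "card {(y1, y2) \<in> T \<times> T. y1 \<otimes> y2 = \<one>} = n"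
proof -
  have T: "T \<subseteq> carrier G" and card_T: "card T = 2 * n - 1"
    and count: "\<And>a. a \<in> carrier G - {\<one>} \<Longrightarrow> card {(y1, y2) \<in> T \<times> T. y1 \<otimes> y2 = a} = n - 1"
    using assms unfolding sum_set_iff by blast+
  let ?N = "\<lambda>a. card {(y1, y2) \<in> T \<times> T. y1 \<otimes> y2 = a}"
  have fin: "finite T" using T finite_carrier by (rule finite_subset)
  have closed: "fst q \<otimes> snd q \<in> carrier G" if "q \<in> T \<times> T" for q
    using that T by (intro m_closed) auto
  have "card T * card T = (\<Sum>q\<in>T \<times> T. 1)" by (simp add: card_cartesian_product)
  also have "\<dots> = (\<Sum>a\<in>carrier G. \<Sum>q\<in>{q \<in> T \<times> T. fst q \<otimes> snd q = a}. 1)"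
    using fin finite_carrier closed by (intro sum.group[symmetric]) auto
  also have "\<dots> = (\<Sum>a\<in>carrier G. ?N a)"
    by (rule sum.cong[OF HOL.refl]) (auto intro!: arg_cong[of _ _ card])
  also have "\<dots> = ?N \<one> + (\<Sum>a\<in>carrier G - {\<one>}. ?N a)"
    by (rule sum.remove[OF finite_carrier one_closed])
  also have "\<dots> = ?N \<one> + (4 * n - 1) * (n - 1)"
    using count finite_carrier by (simp add: card_carrier)
  finally have *: "(2 * n - 1) * (2 * n - 1) = ?N \<one> + (4 * n - 1) * (n - 1)" by (simp add: card_T)
  obtain m where "n = Suc m" using n_pos by (cases n) auto
  with * show ?thesis by (simp add: algebra_simps)
qed

text \<open>\<open>a\<close> and \<open>b\<close> are the coefficients of the indicator of
  \<open>T\<close> modulo t^2 + 1. The vanishing of \<open>b\<close> gives the first claim; then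
  \<open>a\<close> squares to one, and its parity gives the second.\<close>

lemma sum_set_signs:
  assumes ss: "sum_set G (4 * n) (2 * n - 1) (n - 1) T"
  shows "ind T k 1 = ind T k 3" "odd (ind T k 0 - ind T k 2) \<longleftrightarrow> k mod int n = 0"
proof -
  have T: "T \<subseteq> carrier G"
    and count: "\<And>a. a \<in> carrier G - {\<one>} \<Longrightarrow> card {(y1, y2) \<in> T \<times> T. y1 \<otimes> y2 = a} = n - 1"
    using ss unfolding sum_set_iff by blast+
  define a where "a i = ind T i 0 - ind T i 2" for i
  define b where "b i = ind T i 1 - ind T i 3" for i
  have a: "periodic n a" and b: "periodic n b"
    unfolding a_def b_def
    by (rule periodicI, rule arg_cong2[of _ _ _ _ "(-)"]; erule ind_cong, rule HOL.refl)+
  define N where "N k l = (\<Sum>i=0..<int n. \<Sum>j=0..<4. ind T i j * ind T (alt j * (k - i)) (l - j))" for k l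
  \<comment> \<open>At the identity the count is n, one more than the n - 1 found elsewhere.\<close>
  have N: "N k l = int n - 1 + of_bool (k mod int n = 0 \<and> l mod 4 = 0)" for k l
  proof (cases "k mod int n = 0 \<and> l mod 4 = 0")
    case True
    then have "E k l = \<one>" by (simp add: E_one[symmetric] E_eq)
    then show ?thesis
      using True card_factorizations[OF T, of k l] card_factorizations_one[OF ss] by (simp add: N_def)
  next
    case False
    then have "E k l \<in> carrier G - {\<one>}" by (simp add: E_one[symmetric] E_eq E_closed)
    from count[OF this] False show ?thesis
      using card_factorizations[OF T, of k l] n_pos by (auto simp: N_def)
  qed
  have reduce: "ind T i (- 1) = ind T i 3" "ind T i (- 2) = ind T i 2" "ind T i (- 3) = ind T i 1" for i
    by (rule ind_cong; simp)+
  \<comment> \<open>Setting t^2 = -1 subtracts the count at t^2 from that at 1. The common value n -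
    1 cancels and only the extra 1 at the identity survives; in \<open>odd_part\<close> nothing
    survives.\<close>
  have even_part: "(\<Sum>i=0..<int n. a i * a (k - i)) - (\<Sum>i=0..<int n. b i * b (i - k))
    = of_bool (k mod int n = 0)" for k
  proof -
    have "(\<Sum>i=0..<int n. a i * a (k - i)) - (\<Sum>i=0..<int n. b i * b (i - k)) = N k 0 - N k 2"
      unfolding N_def sum_subtractf[symmetric]
      by (rule sum.cong[OF HOL.refl]) (simp add: a_def b_def sum_atLeast0_lessThan_4 alt_def reduce algebra_simps)
    then show ?thesis by (simp add: N)
  qed
  have odd_part: "(\<Sum>i=0..<int n. a i * b (k - i)) + (\<Sum>i=0..<int n. b i * a (i - k)) = 0" for k
  proof -
    have "(\<Sum>i=0..<int n. a i * b (k - i)) + (\<Sum>i=0..<int n. b i * a (i - k)) = N k 1 - N k 3"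
      unfolding N_def sum_subtractf[symmetric] sum.distrib[symmetric]
      by (rule sum.cong[OF HOL.refl]) (simp add: a_def b_def sum_atLeast0_lessThan_4 alt_def reduce algebra_simps)
    then show ?thesis by (simp add: N)
  qed
  have b0: "b i = 0" for i
    by (rule twisted_square_root_of_one[OF n_pos a b even_part odd_part])
  then show "ind T k 1 = ind T k 3" by (simp add: b_def)
  show "odd (ind T k 0 - ind T k 2) \<longleftrightarrow> k mod int n = 0"
    using square_root_of_one_parity[OF odd_n a, of k] even_part by (simp add: b0 a_def)
qed

lemma central_involution: "E 0 2 \<otimes> E i j = E i j \<otimes> E 0 2"
  by (simp add: E_mult alt_def add.commute)

lemma normal_center: "{\<one>, E 0 2} \<lhd> G"
proof (rule normalI)
  have sq: "E 0 2 \<otimes> E 0 2 = \<one>" by (simp add: E_mult E_one[symmetric] E_eq)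
  then have "inv (E 0 2) = E 0 2" by (intro inv_equality) (auto simp: E_closed)
  then show "subgroup {\<one>, E 0 2} G"
    by (intro subgroupI) (auto simp: E_closed sq)
  show "\<forall>x\<in>carrier G. {\<one>, E 0 2} #> x = x <# {\<one>, E 0 2}"
  proof
    fix x assume x: "x \<in> carrier G"
    then have "E 0 2 \<otimes> x = x \<otimes> E 0 2" using E_cases central_involution by blast
    then show "{\<one>, E 0 2} #> x = x <# {\<one>, E 0 2}"
      using x by (auto simp: r_coset_def l_coset_def)
  qed
qed

text \<open>The cosets are the pairs \<open>{E i j, E i (j + 2)}\<close>. On the subgroup itself the
  two indicator values differ by an odd number, so exactly one element lies in \<open>T\<close>; on
  every other coset they agree.\<close>

lemma sum_set_type2:
  assumes ss: "sum_set G (4 * n) (2 * n - 1) (n - 1) T"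
  shows "type2 G {\<one>, E 0 2} T"
proof -
  have coset: "{\<one>, E 0 2} #> E i j = {E i j, E i (j + 2)}" for i j
    by (auto simp: r_coset_def E_closed E_mult alt_def add.commute)
  have ne: "E i j \<noteq> E i (j + 2)" for i j
    unfolding E_eq by presburger
  have card_coset: "int (card (T \<inter> {E i j, E i (j + 2)})) = ind T i j + ind T i (j + 2)" for i j
    using ne[of i j] by (auto simp: ind_def Int_insert_right)
  have bounds: "ind T i j \<in> {0, 1}" for i j by (simp add: ind_def)
  \<comment> \<open>For odd j this is the first part of \<open>sum_set_signs\<close>. For even j the
    second part makes the difference of two values in {0, 1} even, hence zero.\<close>
  have equal: "ind T i j = ind T i (j + 2)" if "\<not> (i mod int n = 0 \<and> even j)" for i j
  proof -
    have reduce: "ind T i j' = ind T i (j' mod 4)" for j' by (rule ind_cong) simp_all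
    have "j mod 4 = 0 \<and> (j + 2) mod 4 = 2 \<or> j mod 4 = 1 \<and> (j + 2) mod 4 = 3
      \<or> j mod 4 = 2 \<and> (j + 2) mod 4 = 0 \<or> j mod 4 = 3 \<and> (j + 2) mod 4 = 1"
      by presburger
    moreover have "ind T i 0 = ind T i 2" if "even j"
      using sum_set_signs(2)[OF ss, of i] that \<open>\<not> (i mod int n = 0 \<and> even j)\<close> bounds[of i 0] bounds[of i 2]
      by auto
    moreover have "even j \<longleftrightarrow> j mod 4 = 0 \<or> j mod 4 = 2" by presburger
    ultimately show ?thesis
      using sum_set_signs(1)[OF ss, of i] reduce[of j] reduce[of "j + 2"]
      by (elim disjE conjE) simp_all
  qed
  have "card (T \<inter> {\<one>, E 0 2}) = 1"
    using sum_set_signs(2)[OF ss, of 0] card_coset[of 0 0] bounds[of 0 0] bounds[of 0 2]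
    by (auto simp: E_one)
  moreover have "card (T \<inter> C) \<in> {0, 2}"
    if C: "C \<in> rcosets {\<one>, E 0 2}" and "C \<noteq> {\<one>, E 0 2}" for C
  proof -
    obtain g where "g \<in> carrier G" "C = {\<one>, E 0 2} #> g"
      using C by (auto simp: RCOSETS_def)
    then obtain i j where C_eq: "C = {E i j, E i (j + 2)}" using E_cases coset by metis
    \<comment> \<open>Otherwise the pair would be the subgroup itself.\<close>
    have "\<not> (i mod int n = 0 \<and> even j)"
    proof
      assume ij: "i mod int n = 0 \<and> even j"
      have "j mod 4 = 0 \<and> (j + 2) mod 4 = 2 \<or> j mod 4 = 2 \<and> (j + 2) mod 4 = 0" if "even j"
        using that by presburger
      with ij have "E i j = E 0 0 \<and> E i (j + 2) = E 0 2 \<or> E i j = E 0 2 \<and> E i (j + 2) = E 0 0"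
        by (simp add: E_eq)
      then show False using that(2) C_eq by (auto simp: E_one)
    qed
    then show ?thesis using card_coset[of i j] equal[of i j] bounds[of i "j + 2"] by (auto simp: C_eq)
  qed
  moreover have "card {\<one>, E 0 2} = 2" using ne[of 0 0] by (simp add: E_one)
  ultimately show ?thesis using normal_center by (simp add: type2_def)
qed

section \<open>The center\<close>

text \<open>Commuting with x forces \<open>alt j = 1\<close>, since n is at least 3 and cannot
  divide 2; commuting with t forces n to divide 2i, hence i. For n = 1 the group is cyclic of order
  4 and equals its center.\<close>

lemma center_eq:
  assumes "n > 1"
  shows "center G = {\<one>, E 0 2}"
proof (intro equalityI subsetI)
  fix z assume z: "z \<in> center G"
  then obtain i j where ij: "z = E i j" using E_cases unfolding center_def by blast
  have comm: "E i j \<otimes> g = g \<otimes> E i j" if "g \<in> carrier G" for g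
    using z that by (simp add: center_def ij)
  have "n \<noteq> 2" using odd_n by auto
  then have n3: "n \<ge> 3" using assms by simp
  have "(i + alt j) mod int n = (1 + i) mod int n"
    using comm[OF E_closed, of 1 0] by (simp add: E_mult E_eq alt_def)
  then have "int n dvd alt j - 1" by (simp add: mod_eq_dvd_iff)
  then have "even j" using n3 zdvd_imp_le[of "int n" 2] by (auto simp: alt_def split: if_splits)
  have "i mod int n = (- i) mod int n"
    using comm[OF E_closed, of 0 1] by (simp add: E_mult E_eq alt_def)
  then have "int n dvd 2 * i" by (simp add: mod_eq_dvd_iff)
  then have "int n dvd i" using odd_n by (simp add: coprime_dvd_mult_right_iff)
  then have "i mod int n = 0" by simp
  moreover have "j mod 4 = 0 \<or> j mod 4 = 2" using \<open>even j\<close> by presburger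
  ultimately have "E i j = E 0 0 \<or> E i j = E 0 2" by (auto simp: E_eq)
  then show "z \<in> {\<one>, E 0 2}" by (auto simp: ij E_one)
next
  fix z assume "z \<in> {\<one>, E 0 2}"
  then show "z \<in> center G"
    using E_cases central_involution by (fastforce simp: center_def E_closed)
qed

end

section \<open>Commutation of powers\<close>

text \<open>Induction handles natural exponents, and cancelling powers handles negative ones. Two
  elements \<open>x\<close> and \<open>y\<close> are allowed so that both inversion by t and
  commutation with t^2 are instances.\<close>

lemma (in group) intertwine_int_pow:
  assumes closed: "g \<in> carrier G" "x \<in> carrier G" "y \<in> carrier G"
    and comm: "g \<otimes> x = y \<otimes> g"
  shows "g \<otimes> x [^] (i :: int) = y [^] i \<otimes> g"
proof -
  have nat: "g \<otimes> x [^] (k :: nat) = y [^] k \<otimes> g" for k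
  proof (induction k)
    case (Suc k)
    have "g \<otimes> x [^] Suc k = (g \<otimes> x [^] k) \<otimes> x" using closed by (simp add: m_assoc)
    also have "\<dots> = y [^] k \<otimes> (g \<otimes> x)" using closed by (simp add: Suc.IH m_assoc)
    also have "\<dots> = y [^] Suc k \<otimes> g" using closed by (simp add: comm m_assoc)
    finally show ?case .
  qed (use closed in simp)
  show ?thesis
  proof (cases i rule: int_cases2)
    case (nonneg k)
    then show ?thesis using nat[of k] by (simp add: int_pow_int)
  next
    case (nonpos k)
    have "y [^] k \<otimes> (g \<otimes> inv (x [^] k)) = (g \<otimes> x [^] k) \<otimes> inv (x [^] k)"
      using closed by (simp add: nat m_assoc)
    also have "\<dots> = g" using closed by (simp add: m_assoc)
    finally have "g \<otimes> inv (x [^] k) = inv (y [^] k) \<otimes> g"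
      using closed by (metis inv_solve_left inv_closed m_closed nat_pow_closed)
    then show ?thesis using closed by (simp add: nonpos int_pow_neg int_pow_int)
  qed
qed

lemma (in group) int_pow_mod:
  assumes x: "x \<in> carrier G" and m: "x [^] (m :: nat) = \<one>"
  shows "x [^] (i mod int m) = x [^] i"
proof -
  have "x [^] i = x [^] (int m * (i div int m) + i mod int m)" by simp
  also have "\<dots> = x [^] (int m * (i div int m)) \<otimes> x [^] (i mod int m)"
    using x by (rule int_pow_mult)
  also have "x [^] (int m * (i div int m)) = \<one>"
    using x m by (simp add: int_pow_pow[symmetric] int_pow_int int_pow_one)
  finally show ?thesis using x by simp
qed

text \<open>One factor t inverts powers of x, so t^2 commutes with them, and only the parity of
  \<open>j\<close> matters.\<close>

lemma (in group) int_pow_mult_int_pow_inverted: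
  assumes x: "x \<in> carrier G" and t: "t \<in> carrier G" and conj: "inv t \<otimes> x \<otimes> t = inv x"
  shows "t [^] j \<otimes> x [^] (i :: int) = x [^] (alt j * i) \<otimes> t [^] (j :: int)"
proof -
  have xt: "x \<otimes> t = t \<otimes> inv x"
    using x t conj[symmetric] by (simp add: m_assoc[symmetric])
  have "inv x \<otimes> t = inv x \<otimes> (t \<otimes> inv x) \<otimes> x" using x t by (simp add: m_assoc)
  also have "\<dots> = t \<otimes> x" using x t by (simp add: xt[symmetric] m_assoc[symmetric])
  finally have tx: "t \<otimes> x = inv x \<otimes> t" by simp
  have t_pow: "t \<otimes> x [^] k = x [^] (- k) \<otimes> t" for k :: int
    using intertwine_int_pow[OF t x inv_closed[OF x] tx, of k] x
    by (simp add: int_pow_inv int_pow_neg)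
  let ?t2 = "t \<otimes> t"
  have "?t2 \<otimes> x [^] k = t \<otimes> (x [^] (- k) \<otimes> t)" for k :: int
    using x t by (simp add: m_assoc t_pow)
  also have "t \<otimes> (x [^] (- k) \<otimes> t) = x [^] k \<otimes> ?t2" for k :: int
    using x t by (simp add: m_assoc[symmetric] t_pow)
  finally have t2: "?t2 \<otimes> x [^] k = x [^] k \<otimes> ?t2" for k :: int .
  have even_pow: "t [^] (2 * l) \<otimes> x [^] k = x [^] k \<otimes> t [^] (2 * l)" for k l :: int
  proof -
    have "t [^] (2 * l) = (t [^] (2 :: int)) [^] l" using t by (simp add: int_pow_pow)
    also have "t [^] (2 :: int) = ?t2"
      using t int_pow_mult[OF t, of 1 1] by (simp add: int_pow_1)
    finally show ?thesis
      using intertwine_int_pow[of "x [^] k" ?t2 ?t2 l] x t t2[of k] by simp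
  qed
  show ?thesis
  proof (cases "even j")
    case True
    then show ?thesis using even_pow by (auto simp: alt_def elim!: evenE)
  next
    case False
    then obtain l where j: "j = 2 * l + 1" by (rule oddE)
    have tj: "t [^] j = t [^] (2 * l) \<otimes> t" using t by (simp add: j int_pow_mult int_pow_1)
    have "t [^] j \<otimes> x [^] i = t [^] (2 * l) \<otimes> x [^] (- i) \<otimes> t"
      using x t by (simp add: tj m_assoc t_pow)
    then show ?thesis using x t False by (simp add: even_pow tj m_assoc alt_def)
  qed
qed

section \<open>Normal forms of words\<close>

text \<open>Right multiplication by a letter, where \<open>(i, j)\<close> stands for \<open>x\<^sup>i t\<^sup>j\<close>.\<close>

fun letter_action :: "int \<times> int \<Rightarrow> dgen \<times> bool \<Rightarrow> int \<times> int"
  where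
    "letter_action (i, j) (Gen_x, b) = (i + (if b then alt j else - alt j), j)"
  | "letter_action (i, j) (Gen_t, b) = (i, j + (if b then 1 else - 1))"

text \<open>Exponents are kept as integers, so the relators fix a pair only up to this
  relation.\<close>

definition same_normal_form :: "nat \<Rightarrow> int \<times> int \<Rightarrow> int \<times> int \<Rightarrow> bool"
  where "same_normal_form n p q \<longleftrightarrow>
    fst p mod int n = fst q mod int n \<and> snd p mod 4 = snd q mod 4"

text \<open>The letter x shifts the first exponent by \<open>alt j\<close> or its negative, which
  depends only on \<open>j\<close> modulo 2 and so on \<open>j\<close> modulo 4.\<close>

lemma letter_action_cong:
  assumes "same_normal_form n p q"
  shows "same_normal_form n (letter_action p l) (letter_action q l)"
proof -
  obtain i j i' j' where pq: "p = (i, j)" "q = (i', j')" by (cases p, cases q)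
  have i: "i mod int n = i' mod int n" and j: "j mod 4 = j' mod 4"
    using assms by (simp_all add: pq same_normal_form_def)
  from j have "even j \<longleftrightarrow> even j'" by presburger
  then have "alt j = alt j'" by (simp add: alt_def)
  obtain g b where l: "l = (g, b)" by (cases l)
  show ?thesis
    by (cases g) (auto simp: l pq same_normal_form_def \<open>alt j = alt j'\<close> i j
        intro: mod_add_cong mod_diff_cong)
qed

lemma foldl_letter_action_cong:
  "same_normal_form n p q \<Longrightarrow>
    same_normal_form n (foldl letter_action p u) (foldl letter_action q u)"
  by (induction u arbitrary: p q) (simp_all add: letter_action_cong)

lemma letter_action_cancel: "letter_action (letter_action p (g, b)) (g, \<not> b) = p"
  by (cases p; cases g) auto

lemma foldl_letter_action_x:
  "foldl letter_action (i, j) (replicate k (Gen_x, True)) = (i + int k * alt j, j)"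
  by (induction k arbitrary: i) (simp_all add: algebra_simps)

lemma foldl_letter_action_t:
  "foldl letter_action (i, j) (replicate k (Gen_t, True)) = (i, j + int k)"
  by (induction k arbitrary: j) simp_all

text \<open>The letter action respects free cancellation and the three relations, so it descends to
  the presented group. This shows that the group does not collapse: words with different exponent
  residues represent different elements.\<close>

lemma word_eq_same_normal_form:
  assumes "word_eq (Dstar_rels n) u v"
  shows "same_normal_form n (foldl letter_action p u) (foldl letter_action p v)"
  using assms
proof (induction arbitrary: p rule: word_eq.induct)
  case (cancel u g b v)
  show ?case by (simp add: letter_action_cancel same_normal_form_def)
next
  case (relation l r u v)
  obtain i j where ij: "foldl letter_action p u = (i, j)" by (cases "foldl letter_action p u")
  have "same_normal_form n (foldl letter_action (i, j) l) (foldl letter_action (i, j) r)"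
    using relation foldl_letter_action_x[of i j n] foldl_letter_action_t[of i j 4]
    by (auto simp: Dstar_rels_def same_normal_form_def alt_def)
  from foldl_letter_action_cong[OF this] show ?case by (simp add: ij)
qed (auto simp: same_normal_form_def)

section \<open>Coordinates on the presented group\<close>

lemma dicyclic_Dstar:
  fixes n :: nat
  assumes n: "odd n"
  defines "x \<equiv> word_class (Dstar_rels n) [(Gen_x, True)]"
  shows "dicyclic (Dstar n) n (\<lambda>i j. x [^]\<^bsub>Dstar n\<^esub> i \<otimes>\<^bsub>Dstar n\<^esub> Dstar_t n [^]\<^bsub>Dstar n\<^esub> j)"
proof -
  let ?G = "Dstar n" and ?cl = "word_class (Dstar_rels n)" and ?t = "Dstar_t n"
  interpret G: group ?G unfolding Dstar_def by (rule group_presented_group)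
  let ?E = "\<lambda>(i :: int) (j :: int). x [^]\<^bsub>?G\<^esub> i \<otimes>\<^bsub>?G\<^esub> ?t [^]\<^bsub>?G\<^esub> j"
  have closed: "?cl u \<in> carrier ?G" for u by (simp add: Dstar_def presented_group_def)
  have cases: "\<exists>u. g = ?cl u" if "g \<in> carrier ?G" for g
    using that by (auto simp: Dstar_def presented_group_def)
  have one: "\<one>\<^bsub>?G\<^esub> = ?cl []" by (simp add: Dstar_def presented_group_def)
  have mult: "?cl u \<otimes>\<^bsub>?G\<^esub> ?cl v = ?cl (u @ v)" for u v
    by (simp add: Dstar_def presented_group_mult)
  have x: "x \<in> carrier ?G" and t: "?t \<in> carrier ?G" by (simp_all add: x_def Dstar_t_def closed)
  have x_pow: "x [^]\<^bsub>?G\<^esub> k = ?cl (replicate k (Gen_x, True))" for k :: nat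
    by (induction k) (simp_all add: one x_def mult replicate_append_same)
  have t_pow: "?t [^]\<^bsub>?G\<^esub> k = ?cl (replicate k (Gen_t, True))" for k :: nat
    by (induction k) (simp_all add: one Dstar_t_def mult replicate_append_same)
  have inverse: "?cl [(g, False)] = inv\<^bsub>?G\<^esub> ?cl [(g, True)]" for g
    using word_eq.cancel[of "Dstar_rels n" "[]" g False "[]"]
    by (intro G.inv_equality[symmetric]) (simp_all add: mult one closed word_class_eq_iff)
  have relator: "?cl l = ?cl r" if "(l, r) \<in> Dstar_rels n" for l r
    using word_eq.relation[OF that, of "[]" "[]"] by (simp add: word_class_eq_iff)
  have x_n: "x [^]\<^bsub>?G\<^esub> n = \<one>\<^bsub>?G\<^esub>"
    unfolding x_pow one by (rule relator) (simp add: Dstar_rels_def)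
  have t_4: "?t [^]\<^bsub>?G\<^esub> (4 :: nat) = \<one>\<^bsub>?G\<^esub>"
    unfolding t_pow one by (rule relator) (simp add: Dstar_rels_def)
  have "?cl [(Gen_t, False), (Gen_x, True), (Gen_t, True)] = ?cl [(Gen_x, False)]"
    by (rule relator) (simp add: Dstar_rels_def)
  then have conj: "inv\<^bsub>?G\<^esub> ?t \<otimes>\<^bsub>?G\<^esub> x \<otimes>\<^bsub>?G\<^esub> ?t = inv\<^bsub>?G\<^esub> x"
    by (simp add: x_def Dstar_t_def inverse[symmetric] mult)
  have E_mult: "?E i j \<otimes>\<^bsub>?G\<^esub> ?E i' j' = ?E (i + alt j * i') (j + j')" for i j i' j'
  proof -
    have "?E i j \<otimes>\<^bsub>?G\<^esub> ?E i' j'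
      = x [^]\<^bsub>?G\<^esub> i \<otimes>\<^bsub>?G\<^esub> (?t [^]\<^bsub>?G\<^esub> j \<otimes>\<^bsub>?G\<^esub> x [^]\<^bsub>?G\<^esub> i') \<otimes>\<^bsub>?G\<^esub> ?t [^]\<^bsub>?G\<^esub> j'"
      using x t by (simp add: G.m_assoc)
    then show ?thesis
      using x t by (simp add: G.int_pow_mult_int_pow_inverted[OF x t conj] G.int_pow_mult G.m_assoc)
  qed
  have E_mod: "?E (i mod int n) (j mod 4) = ?E i j" for i j
    using G.int_pow_mod[OF x x_n, of i] G.int_pow_mod[OF t t_4, of j] by simp
  \<comment> \<open>Reduced exponents are nonnegative, so each element is represented by a word in
    positive letters that depends only on the residues.\<close>
  have E_word: "?E i j = ?cl (replicate (nat (i mod int n)) (Gen_x, True) @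
      replicate (nat (j mod 4)) (Gen_t, True))" for i j
  proof -
    have "i mod int n \<ge> 0" using n by (cases n) auto
    then have "x [^]\<^bsub>?G\<^esub> (i mod int n) = x [^]\<^bsub>?G\<^esub> nat (i mod int n)"
      using int_pow_int[of ?G x "nat (i mod int n)"] by simp
    moreover have "?t [^]\<^bsub>?G\<^esub> (j mod 4) = ?t [^]\<^bsub>?G\<^esub> nat (j mod 4)"
      using int_pow_int[of ?G ?t "nat (j mod 4)"] by simp
    ultimately show ?thesis by (simp add: E_mod[symmetric, of i j] x_pow t_pow mult)
  qed
  show ?thesis
  proof unfold_locales
    show "odd n" by (rule n)
    show "?E i j \<in> carrier ?G" for i j using x t by simp
    show "?E 0 0 = \<one>\<^bsub>?G\<^esub>" by simp
    show "?E i j \<otimes>\<^bsub>?G\<^esub> ?E i' j' = ?E (i + alt j * i') (j + j')" for i j i' j' by (rule E_mult)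
    show "?E i j = ?E i' j' \<longleftrightarrow> i mod int n = i' mod int n \<and> j mod 4 = j' mod 4" for i j i' j'
    proof
      assume "?E i j = ?E i' j'"
      then have "word_eq (Dstar_rels n)
        (replicate (nat (i mod int n)) (Gen_x, True) @ replicate (nat (j mod 4)) (Gen_t, True))
        (replicate (nat (i' mod int n)) (Gen_x, True) @ replicate (nat (j' mod 4)) (Gen_t, True))"
        by (simp only: E_word word_class_eq_iff)
      \<comment> \<open>Started at (0, 0), the action of such a word ends at the pair of its
        exponents, so equal classes have equal residues.\<close>
      from word_eq_same_normal_form[OF this, of "(0, 0)"]
      show "i mod int n = i' mod int n \<and> j mod 4 = j' mod 4"
        using n by (cases "n = 0")
          (simp_all add: foldl_letter_action_x foldl_letter_action_t same_normal_form_def alt_def)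
    next
      assume "i mod int n = i' mod int n \<and> j mod 4 = j' mod 4"
      then show "?E i j = ?E i' j'" by (simp only: E_word)
    qed
    \<comment> \<open>Each letter is \<open>?E\<close> at an exponent pair with entries 0 and 1 or
      -1; \<open>E_mult\<close> then covers all words by induction.\<close>
    have letter: "\<exists>i j. ?cl [l] = ?E i j" for l
    proof -
      obtain g b where l: "l = (g, b)" by (cases l)
      have "?E (if b then 1 else - 1) 0 = (if b then x else inv\<^bsub>?G\<^esub> x)"
        "?E 0 (if b then 1 else - 1) = (if b then ?t else inv\<^bsub>?G\<^esub> ?t)"
        using x t by (simp_all add: G.int_pow_neg G.int_pow_1)
      then show ?thesis
        unfolding l by (cases g; cases b; simp only: inverse x_def[symmetric] Dstar_t_def[symmetric] if_True if_False) metis+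
    qed
    show "\<exists>i j. g = ?E i j" if g: "g \<in> carrier ?G" for g
    proof -
      obtain u where "g = ?cl u" using cases[OF g] by blast
      moreover have "\<exists>i j. ?cl u = ?E i j"
      proof (induction u)
        case Nil
        have "?cl [] = ?E 0 0" by (simp add: one mult)
        then show ?case by blast
      next
        case (Cons l u)
        have "?cl (l # u) = ?cl [l] \<otimes>\<^bsub>?G\<^esub> ?cl u" by (simp add: mult)
        then show ?case using letter[of l] Cons.IH E_mult by metis
      qed
      ultimately show ?thesis by simp
    qed
  qed
qed

theorem theorem6p4:
  fixes n :: nat
  assumes "n > 0" and "odd n"
  shows "(\<exists>T. sum_set (Dstar n) (4 * n) (2 * n - 1) (n - 1) T) \<and>
    (\<forall>T. sum_set (Dstar n) (4 * n) (2 * n - 1) (n - 1) T \<longrightarrow>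
         type2 (Dstar n) {\<one>\<^bsub>Dstar n\<^esub>, Dstar_t n [^]\<^bsub>Dstar n\<^esub> (2::nat)} T) \<and>
    (n > 1 \<longrightarrow> center (Dstar n) = {\<one>\<^bsub>Dstar n\<^esub>, Dstar_t n [^]\<^bsub>Dstar n\<^esub> (2::nat)})"
proof -
  let ?x = "word_class (Dstar_rels n) [(Gen_x, True)]"
  interpret dicyclic "Dstar n" n
    "\<lambda>i j. ?x [^]\<^bsub>Dstar n\<^esub> i \<otimes>\<^bsub>Dstar n\<^esub> Dstar_t n [^]\<^bsub>Dstar n\<^esub> j"
    by (rule dicyclic_Dstar[OF assms(2)])
  have t: "Dstar_t n \<in> carrier (Dstar n)"
    by (simp add: Dstar_t_def Dstar_def presented_group_def)
  \<comment> \<open>Identifies the central involution \<open>E 0 2\<close>, written with integer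
    exponents, with the natural power of t in the claim.\<close>
  have "?x [^]\<^bsub>Dstar n\<^esub> (0 :: int) \<otimes>\<^bsub>Dstar n\<^esub> Dstar_t n [^]\<^bsub>Dstar n\<^esub> (2 :: int)
      = Dstar_t n [^]\<^bsub>Dstar n\<^esub> (2 :: nat)"
    using t int_pow_int[of "Dstar n" "Dstar_t n" 2] by simp
  with sum_set_exists sum_set_type2 center_eq show ?thesis by simp
qed

end
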